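(* Let $\Gamma=[\gamma_{\min},\gamma_{\max}]^2$ with $\gamma_{\min}>0$, let $\Gamma_{\mathrm{cand}}\subset\Gamma$ be a finite nonempty candidate set, $J:\Gamma_{\mathrm{cand}}\to\mathbb{R}$, $\tau_s>0$, $\kappa>0$. For a real-valued predictor $\hat\Phi$ of pairs $(s,\gamma)$, define the selected parameter $$\gamma^*(s;\hat\Phi)=\frac{\sum_{\gamma\in\Gamma_{\mathrm{cand}}}\gamma\,w(\gamma,s)}{\sum_{\gamma\in\Gamma_{\mathrm{cand}}}w(\gamma,s)},\qquad w(\gamma,s)=\exp\!\big(J(\gamma)/\tau_s-\kappa\,\mathrm{softplus}(\hat\Phi(s,\gamma))\big),\qquad\mathrm{softplus}(y)=\ln(1+e^y).$$ Then $\gamma^*$ is $L_{\mathcal{M}}$-Lipschitz in $\hat\Phi$: for any two predictors $\hat\Phi,\hat\Phi'$, $$\|\gamma^*(\hat\Phi)-\gamma^*(\hat\Phi')\|\le L_{\mathcal{M}}\,\|\hat\Phi-\hat\Phi'\|_\infty,$$ with $L_{\mathcal{M}}=\kappa\cdot\mathrm{diam}(\Gamma)$, where $\mathrm{diam}(\Gamma)=\sqrt2(\gamma_{\max}-\gamma_{\min})$.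
   Context: $\|\cdot\|$ on $\mathbb{R}^2$ is the Euclidean norm, $\|\cdot\|_\infty$ is the sup norm, and the inequality is understood at each fixed $s$. $J$ is called the aggressiveness criterion, $\tau_s$ the temperature, $\kappa$ the safety penalty gain. *)

theory Defs
  imports "HOL-Analysis.Analysis"
begin

definition param_square :: "real \<Rightarrow> real \<Rightarrow> (real ^ 2) set" where
  "param_square \<gamma>min \<gamma>max = {\<gamma>. \<forall>i. \<gamma> $ i \<in> {\<gamma>min..\<gamma>max}}"

definition softplus :: "real \<Rightarrow> real" where
  "softplus y = ln (1 + exp y)"

definition weight ::
  "(real ^ 2 \<Rightarrow> real) \<Rightarrow> real \<Rightarrow> real \<Rightarrow> ('s \<times> (real ^ 2) \<Rightarrow> real) \<Rightarrow> real ^ 2 \<Rightarrow> 's \<Rightarrow> real" where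
  "weight J \<tau> \<kappa> \<Phi> \<gamma> s = exp (J \<gamma> / \<tau> - \<kappa> * softplus (\<Phi> (s, \<gamma>)))"

definition selected_param ::
  "(real ^ 2) set \<Rightarrow> (real ^ 2 \<Rightarrow> real) \<Rightarrow> real \<Rightarrow> real \<Rightarrow> 's \<Rightarrow> ('s \<times> (real ^ 2) \<Rightarrow> real) \<Rightarrow> real ^ 2" where
  "selected_param C J \<tau> \<kappa> s \<Phi> =
     (\<Sum>\<gamma>\<in>C. weight J \<tau> \<kappa> \<Phi> \<gamma> s *\<^sub>R \<gamma>) /\<^sub>R (\<Sum>\<gamma>\<in>C. weight J \<tau> \<kappa> \<Phi> \<gamma> s)"

(* The supremum is taken in the reals, so this is the sup norm of f on A only if A is
   nonempty and f is bounded on A (in particular if A is finite and nonempty). *)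
definition sup_norm_on :: "'a set \<Rightarrow> ('a \<Rightarrow> real) \<Rightarrow> real" where
  "sup_norm_on A f = (SUP x\<in>A. \<bar>f x\<bar>)"

end

theory Submission
  imports Defs
begin

text \<open>
  Write \<open>m\<close>, \<open>m'\<close> for the means of the candidates under weights \<open>w\<close>, \<open>w'\<close> with
  \<open>w' = w * exp d\<close> and \<open>\<bar>d\<bar> \<le> a\<close>. The deviations from \<open>m\<close> have \<open>w\<close>-sum zero, so for every
  constant \<open>c\<close> the difference \<open>m' - m\<close> is the \<open>w'\<close>-mean of \<open>(1 - c * exp (- d)) (x - m)\<close>. The choice
  \<open>c = 1 / cosh a\<close> balances the two extremes \<open>d = a\<close> and \<open>d = - a\<close> and makes the scalar factor at most
  \<open>tanh a \<le> a\<close> in absolute value. Since softplus is 1-Lipschitz, \<open>a\<close> can be taken to be \<open>\<kappa>\<close> times the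
  sup distance of the predictors.
\<close>

lemma tanh_le_self:
  fixes a :: real
  assumes "0 \<le> a"
  shows "tanh a \<le> a"
proof -
  have "((\<lambda>x. x - tanh x) has_real_derivative tanh x ^ 2) (at x)" for x :: real
    by (auto intro!: derivative_eq_intros)
  then have "0 - tanh 0 \<le> a - tanh a"
    by (intro DERIV_nonneg_imp_nondecreasing[OF assms]) (auto intro: zero_le_power2)
  then show ?thesis by simp
qed

text \<open>The value \<open>exp (- d)\<close> lies between \<open>exp (- a)\<close> and
  \<open>exp a\<close>, an interval with centre \<open>cosh a\<close> and radius
  \<open>sinh a\<close>; dividing by the centre gives relative error \<open>tanh a\<close>.\<close>

lemma abs_one_minus_exp_div_cosh_le_tanh:
  fixes a d :: real
  assumes "\<bar>d\<bar> \<le> a"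
  shows "\<bar>1 - exp (- d) / cosh a\<bar> \<le> tanh a"
proof -
  have "exp (- d) \<le> exp a" "exp (- a) \<le> exp (- d)"
    using assms by auto
  moreover have "cosh a + sinh a = exp a" "cosh a - sinh a = exp (- a)"
    by (simp_all add: cosh_plus_sinh cosh_minus_sinh)
  ultimately have "\<bar>cosh a - exp (- d)\<bar> \<le> sinh a"
    by linarith
  then have "\<bar>cosh a - exp (- d)\<bar> / cosh a \<le> tanh a"
    by (simp add: tanh_def divide_right_mono)
  moreover have "\<bar>1 - exp (- d) / cosh a\<bar> = \<bar>cosh a - exp (- d)\<bar> / cosh a"
    by (simp add: abs_div_pos diff_divide_distrib)
  ultimately show ?thesis by simp
qed

lemma norm_weighted_mean_diff_le:
  fixes x :: "'i \<Rightarrow> 'a :: euclidean_space" and w d :: "'i \<Rightarrow> real"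
  assumes A: "finite A" "A \<noteq> {}"
    and w: "\<And>i. i \<in> A \<Longrightarrow> 0 < w i"
    and d: "\<And>i. i \<in> A \<Longrightarrow> \<bar>d i\<bar> \<le> a"
    and w': "\<And>i. i \<in> A \<Longrightarrow> w' i = w i * exp (d i)"
    and S: "convex S" "bounded S" "x ` A \<subseteq> S"
  shows "norm ((\<Sum>i\<in>A. w' i *\<^sub>R x i) /\<^sub>R sum w' A - (\<Sum>i\<in>A. w i *\<^sub>R x i) /\<^sub>R sum w A)
    \<le> a * diameter S"
proof -
  define m where "m = (\<Sum>i\<in>A. w i *\<^sub>R x i) /\<^sub>R sum w A"
  have w'_pos: "0 < w' i" if "i \<in> A" for i
    using that by (simp add: w w')
  have W: "0 < sum w A" and W': "0 < sum w' A"
    using A w w'_pos by (auto intro: sum_pos)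
  have "0 \<le> a"
    using A d by fastforce
  \<comment> \<open>As a convex combination of points of \<open>S\<close>, the mean \<open>m\<close>
    lies in \<open>S\<close>, so every deviation from it is bounded by the diameter.\<close>
  have "m = (\<Sum>i\<in>A. (w i / sum w A) *\<^sub>R x i)"
    by (simp add: m_def scaleR_right.sum divide_inverse mult.commute)
  also have "\<dots> \<in> S"
    using A W S w by (intro convex_sum) (auto simp: less_imp_le simp flip: sum_divide_distrib)
  finally have "m \<in> S" .
  then have dist_m: "norm (x i - m) \<le> diameter S" if "i \<in> A" for i
    using diameter_bounded_bound[OF S(2), of "x i" m] S(3) that by (auto simp: dist_norm)
  have sum_m: "sum w A *\<^sub>R m = (\<Sum>i\<in>A. w i *\<^sub>R x i)"
    using W by (simp add: m_def)
  have zero: "(\<Sum>i\<in>A. w i *\<^sub>R (x i - m)) = 0"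
    by (simp add: scaleR_diff_right sum_subtractf sum_m flip: scaleR_left.sum)
  have "sum w' A *\<^sub>R ((\<Sum>i\<in>A. w' i *\<^sub>R x i) /\<^sub>R sum w' A - m) = (\<Sum>i\<in>A. w' i *\<^sub>R (x i - m))"
    using W' by (simp add: scaleR_diff_right sum_subtractf flip: scaleR_left.sum)
  \<comment> \<open>The balancing constant enters as a multiple of a vanishing sum; since
    \<open>w i = w' i * exp (- d i)\<close>, both sums merge into one weighted by
    \<open>w'\<close>.\<close>
  also have "\<dots> = (\<Sum>i\<in>A. w' i *\<^sub>R (x i - m)) - (1 / cosh a) *\<^sub>R (\<Sum>i\<in>A. w i *\<^sub>R (x i - m))"
    by (simp add: zero)
  also have "\<dots> = (\<Sum>i\<in>A. (w' i * (1 - exp (- d i) / cosh a)) *\<^sub>R (x i - m))"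
    unfolding scaleR_right.sum sum_subtractf[symmetric]
  proof (rule sum.cong)
    fix i assume "i \<in> A"
    then have "w' i * (1 - exp (- d i) / cosh a) = w' i - 1 / cosh a * w i"
      by (simp add: w' exp_minus right_diff_distrib)
    then show "w' i *\<^sub>R (x i - m) - (1 / cosh a) *\<^sub>R w i *\<^sub>R (x i - m)
        = (w' i * (1 - exp (- d i) / cosh a)) *\<^sub>R (x i - m)"
      by (simp add: scaleR_left_diff_distrib)
  qed simp
  finally have eq: "sum w' A *\<^sub>R ((\<Sum>i\<in>A. w' i *\<^sub>R x i) /\<^sub>R sum w' A - m) = \<dots>" .
  have "sum w' A * norm ((\<Sum>i\<in>A. w' i *\<^sub>R x i) /\<^sub>R sum w' A - m)
      = norm (sum w' A *\<^sub>R ((\<Sum>i\<in>A. w' i *\<^sub>R x i) /\<^sub>R sum w' A - m))"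
    using W' by simp
  also have "\<dots> \<le> (\<Sum>i\<in>A. w' i * (a * diameter S))"
    unfolding eq
  proof (rule sum_norm_le)
    fix i assume i: "i \<in> A"
    have "\<bar>1 - exp (- d i) / cosh a\<bar> \<le> a"
      using abs_one_minus_exp_div_cosh_le_tanh[OF d[OF i]] tanh_le_self[OF \<open>0 \<le> a\<close>] by linarith
    then have "\<bar>1 - exp (- d i) / cosh a\<bar> * norm (x i - m) \<le> a * diameter S"
      using \<open>0 \<le> a\<close> dist_m[OF i] by (intro mult_mono) auto
    then show "norm ((w' i * (1 - exp (- d i) / cosh a)) *\<^sub>R (x i - m)) \<le> w' i * (a * diameter S)"
      using w'_pos[OF i] by (simp add: abs_mult mult.assoc)
  qed
  also have "\<dots> = sum w' A * (a * diameter S)"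
    by (simp add: sum_distrib_right)
  finally show ?thesis
    using W' by (simp add: m_def)
qed

text \<open>No derivative is taken: for \<open>y \<le> x\<close>, the product
  \<open>exp (x - y) * (1 + exp y)\<close> equals \<open>exp (x - y) + exp x\<close>, hence is at
  least \<open>1 + exp x\<close>. Logarithms bound the increase, and monotonicity rules out a
  decrease.\<close>

lemma softplus_diff_le: "\<bar>softplus x - softplus y\<bar> \<le> \<bar>x - y\<bar>"
proof -
  have *: "softplus x \<le> softplus y + (x - y)" if "y \<le> x" for x y
  proof -
    have "1 + exp x \<le> exp (x - y) * (1 + exp y)"
      using that by (simp add: distrib_left flip: exp_add)
    then have "ln (1 + exp x) \<le> ln (exp (x - y) * (1 + exp y))"
      by (simp add: add_pos_pos)
    then show ?thesis
      by (simp add: softplus_def ln_mult add_pos_pos less_imp_neq[THEN not_sym])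
  qed
  have mono: "softplus y \<le> softplus x" if "y \<le> x" for x y
    using that by (simp add: softplus_def add_pos_pos)
  show ?thesis
    using *[of x y] *[of y x] mono[of x y] mono[of y x] by linarith
qed

text \<open>The box form gives access to convexity, boundedness and the diameter formula.\<close>

lemma param_square_eq_cbox: "param_square l u = cbox (vec l) (vec u)"
  by (auto simp: param_square_def mem_box_cart)

text \<open>For \<open>u < l\<close> the square is empty with diameter 0, while the right-hand side
  is negative.\<close>

lemma diameter_param_square:
  assumes "l \<le> u"
  shows "diameter (param_square l u) = sqrt 2 * (u - l)"
proof -
  have "diameter (param_square l u) = dist (vec l :: real ^ 2) (vec u)"
    unfolding param_square_eq_cbox
    using assms by (intro diameter_cbox) (auto simp: Basis_vec_def inner_axis)
  also have "\<dots> = sqrt (2 * (u - l)\<^sup>2)"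
    by (simp add: dist_norm norm_vec_def L2_set_def power2_commute)
  also have "\<dots> = sqrt 2 * (u - l)"
    using assms by (simp add: real_sqrt_mult)
  finally show ?thesis .
qed

theorem lemma1:
  fixes \<gamma>min \<gamma>max \<tau> \<kappa> :: real
    and C :: "(real ^ 2) set"
    and J :: "real ^ 2 \<Rightarrow> real"
  assumes "\<gamma>min > 0"
    and "C \<subseteq> param_square \<gamma>min \<gamma>max" and "finite C" and "C \<noteq> {}"
    and "\<tau> > 0" and "\<kappa> > 0"
  shows "(\<forall>(\<Phi> :: 's \<times> (real ^ 2) \<Rightarrow> real) (\<Phi>' :: 's \<times> (real ^ 2) \<Rightarrow> real) s.
            norm (selected_param C J \<tau> \<kappa> s \<Phi> - selected_param C J \<tau> \<kappa> s \<Phi>')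
              \<le> \<kappa> * diameter (param_square \<gamma>min \<gamma>max)
                  * sup_norm_on C (\<lambda>\<gamma>. \<Phi> (s, \<gamma>) - \<Phi>' (s, \<gamma>)))
       \<and> diameter (param_square \<gamma>min \<gamma>max) = sqrt 2 * (\<gamma>max - \<gamma>min)"
proof (intro conjI allI)
  \<comment> \<open>The order of the endpoints is not assumed; it follows from a candidate lying in
    the square.\<close>
  obtain g where "g \<in> param_square \<gamma>min \<gamma>max"
    using assms by blast
  then have "\<gamma>min \<le> \<gamma>max"
    by (force simp: param_square_def)
  then show "diameter (param_square \<gamma>min \<gamma>max) = sqrt 2 * (\<gamma>max - \<gamma>min)"
    by (rule diameter_param_square)
next
  fix \<Phi> \<Phi>' :: "'s \<times> (real ^ 2) \<Rightarrow> real" and s :: 's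
  define \<epsilon> where "\<epsilon> = sup_norm_on C (\<lambda>\<gamma>. \<Phi> (s, \<gamma>) - \<Phi>' (s, \<gamma>))"
  \<comment> \<open>The log-ratio of the weights, in which the \<open>J\<close> terms cancel. Its
    sign makes the weights of \<open>\<Phi>'\<close> the base weights \<open>w\<close> and those of
    \<open>\<Phi>\<close> the perturbed \<open>w'\<close>.\<close>
  define d where "d \<gamma> = \<kappa> * (softplus (\<Phi>' (s, \<gamma>)) - softplus (\<Phi> (s, \<gamma>)))" for \<gamma>
  have "\<bar>d \<gamma>\<bar> \<le> \<kappa> * \<epsilon>" if "\<gamma> \<in> C" for \<gamma>
  proof -
    have "\<bar>softplus (\<Phi>' (s, \<gamma>)) - softplus (\<Phi> (s, \<gamma>))\<bar> \<le> \<bar>\<Phi> (s, \<gamma>) - \<Phi>' (s, \<gamma>)\<bar>"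
      using softplus_diff_le by (simp add: abs_minus_commute)
    also have "\<dots> \<le> \<epsilon>"
      \<comment> \<open>Finiteness of \<open>C\<close> bounds the differences, so the real supremum
        is a genuine upper bound.\<close>
      unfolding \<epsilon>_def sup_norm_on_def
      using that \<open>finite C\<close> by (intro cSUP_upper) auto
    finally show ?thesis
      using \<open>\<kappa> > 0\<close> by (simp add: d_def abs_mult)
  qed
  moreover have "weight J \<tau> \<kappa> \<Phi> \<gamma> s = weight J \<tau> \<kappa> \<Phi>' \<gamma> s * exp (d \<gamma>)" for \<gamma>
    by (simp add: weight_def d_def algebra_simps flip: exp_add)
  ultimately have "norm (selected_param C J \<tau> \<kappa> s \<Phi> - selected_param C J \<tau> \<kappa> s \<Phi>')
      \<le> \<kappa> * \<epsilon> * diameter (param_square \<gamma>min \<gamma>max)"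
    unfolding selected_param_def
    using assms
    by (intro norm_weighted_mean_diff_le[where d = d])
      (auto simp: weight_def param_square_eq_cbox)
  then show "norm (selected_param C J \<tau> \<kappa> s \<Phi> - selected_param C J \<tau> \<kappa> s \<Phi>')
      \<le> \<kappa> * diameter (param_square \<gamma>min \<gamma>max) * sup_norm_on C (\<lambda>\<gamma>. \<Phi> (s, \<gamma>) - \<Phi>' (s, \<gamma>))"
    by (simp add: \<epsilon>_def mult_ac)
qed

end
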